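(* For all $x\in\mathbb{D}$ and $v\in T_x\mathbb{D}\cong\mathbb{R}^2$ one has $(\eta^*F_L)(x,v)=F_F(x,v)$; that is, the pullback of the metric $F_L$ on the upper sheet $\mathbb{H}_+$ of the hyperboloid of two sheets by the map $\eta$ is the Funk metric on the unit disc.
   Context: $\mathbb{D}=\{x=(x_1,x_2)\in\mathbb{R}^2: |x|<1\}$, with $|\cdot|$ and $\langle\cdot,\cdot\rangle$ the Euclidean norm and inner product. The Funk metric on $\mathbb{D}$ is $F_F(x,v)=\dfrac{\sqrt{(1-|x|^2)|v|^2+\langle x,v\rangle^2}}{1-|x|^2}+\dfrac{\langle x,v\rangle}{1-|x|^2}$. On $\mathbb{R}^3_+=\{\tilde x\in\mathbb{R}^3:\tilde x_3>0\}$ let $F_L(\tilde x,\tilde v)=\sqrt{\tilde v_1^2+\tilde v_2^2-\tilde v_3^2}+\dfrac{\tilde v_3}{\tilde x_3}$ (defined for those $\tilde v\in\mathbb{R}^3$ for which the radicand is non-negative, in particular for $\tilde v$ tangent to $\mathbb{H}_+$ at $\tilde x \in \mathbb{H}_+$). Here $\mathbb{H}_+=\{\tilde x\in\mathbb{R}^3:\tilde x_3=\sqrt{1+\tilde x_1^2+\tilde x_2^2}\}$ and $\eta:\mathbb{D}\to\mathbb{H}_+$ is the diffeomorphism $\eta(x)=\left(\dfrac{x}{\sqrt{1-|x|^2}},\dfrac{1}{\sqrt{1-|x|^2}}\right)$. The pullback is $(\eta^*F_L)(x,v)=F_L(\eta(x),D\eta_x(v))$. *)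

theory Defs
  imports "HOL-Analysis.Analysis"
begin

definition unit_disc :: "(real^2) set" where
  "unit_disc = {x. norm x < 1}"

definition funk_metric :: "real^2 \<Rightarrow> real^2 \<Rightarrow> real" where
  "funk_metric x v =
     sqrt ((1 - (norm x)\<^sup>2) * (norm v)\<^sup>2 + (x \<bullet> v)\<^sup>2) / (1 - (norm x)\<^sup>2)
     + (x \<bullet> v) / (1 - (norm x)\<^sup>2)"

definition upper_half_space :: "(real^3) set" where
  "upper_half_space = {p. p $ 3 > 0}"

definition hyperboloid :: "(real^3) set" where
  "hyperboloid = {p. p $ 3 = sqrt (1 + (p $ 1)\<^sup>2 + (p $ 2)\<^sup>2)}"

definition minkowski_form :: "real^3 \<Rightarrow> real" where
  "minkowski_form w = (w $ 1)\<^sup>2 + (w $ 2)\<^sup>2 - (w $ 3)\<^sup>2"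

text \<open>The metric is only meaningful at points of the upper half space and on vectors
  with non-negative Minkowski form. Elsewhere the total functions \<^const>\<open>sqrt\<close> and
  division return irrelevant values; the lemmas below show that the pullback along
  \<open>eta\<close> never evaluates it there.\<close>
definition lorentz_metric :: "real^3 \<Rightarrow> real^3 \<Rightarrow> real" where
  "lorentz_metric p w = sqrt (minkowski_form w) + w $ 3 / p $ 3"

definition eta :: "real^2 \<Rightarrow> real^3" where
  "eta x = vector [x $ 1 / sqrt (1 - (norm x)\<^sup>2), x $ 2 / sqrt (1 - (norm x)\<^sup>2),
                   1 / sqrt (1 - (norm x)\<^sup>2)]"

definition pullback ::
  "('a::real_normed_vector \<Rightarrow> 'b::real_normed_vector) \<Rightarrow> ('b \<Rightarrow> 'b \<Rightarrow> real) \<Rightarrow> 'a \<Rightarrow> 'a \<Rightarrow> real" where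
  "pullback f F x v = F (f x) (frechet_derivative f (at x) v)"

lemma norm2_sq: "(norm (x::real^2))\<^sup>2 = (x $ 1)\<^sup>2 + (x $ 2)\<^sup>2"
  by (simp add: norm_vec_def L2_set_def sum_2)

lemma unit_disc_pos: "x \<in> unit_disc \<Longrightarrow> 1 - (norm x)\<^sup>2 > 0"
  by (simp add: unit_disc_def abs_square_less_1)

lemma hyperboloid_subset: "hyperboloid \<subseteq> upper_half_space"
  by (auto simp: hyperboloid_def upper_half_space_def intro!: add_pos_nonneg)

lemma eta_in_hyperboloid:
  assumes "x \<in> unit_disc"
  shows "eta x \<in> hyperboloid"
proof -
  define s where "s = 1 - (norm x)\<^sup>2"
  have s: "s > 0" using unit_disc_pos[OF assms] by (simp add: s_def)
  have "1 + (x $ 1 / sqrt s)\<^sup>2 + (x $ 2 / sqrt s)\<^sup>2 = 1 / s"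
  proof -
    have "1 + (x $ 1 / sqrt s)\<^sup>2 + (x $ 2 / sqrt s)\<^sup>2 = (s + (x $ 1)\<^sup>2 + (x $ 2)\<^sup>2) / s"
      using s by (simp add: power_divide add_divide_distrib)
    then show ?thesis by (simp add: s_def norm2_sq)
  qed
  then show ?thesis
    by (simp add: hyperboloid_def eta_def flip: s_def) (simp add: real_sqrt_divide)
qed

lemma eta_differentiable:
  assumes "x \<in> unit_disc"
  shows "eta differentiable (at x)"
proof -
  have pos: "1 - ((x $ 1)\<^sup>2 + (x $ 2)\<^sup>2) > 0"
    using unit_disc_pos[OF assms] by (simp add: norm2_sq)
  define r where "r = (\<lambda>y::real^2. inverse (sqrt (1 - ((y $ 1)\<^sup>2 + (y $ 2)\<^sup>2))))"
  have c: "(\<lambda>y::real^2. y $ i) differentiable (at x)" for i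
    by (rule linear_imp_differentiable) (simp add: bounded_linear.linear bounded_linear_vec_nth)
  have "\<exists>D. (r has_derivative D) (at x)"
    unfolding r_def using pos
    by (intro exI) (rule derivative_intros bounded_linear.has_derivative[OF bounded_linear_vec_nth] | simp)+
  then have r: "r differentiable (at x)" by (simp add: differentiable_def)
  have eq: "eta = (\<lambda>y. (y $ 1 * r y) *\<^sub>R axis 1 1 + (y $ 2 * r y) *\<^sub>R axis 2 1 + r y *\<^sub>R axis 3 1)"
    by (auto simp: fun_eq_iff eta_def vec_eq_iff forall_3 axis_def r_def norm2_sq divide_inverse)
  show ?thesis unfolding eq
    by (intro differentiable_add differentiable_scaleR differentiable_mult c r differentiable_const)
qed

lemma minkowski_form_tangent_nonneg:
  assumes p: "p \<in> hyperboloid" and t: "p $ 1 * w $ 1 + p $ 2 * w $ 2 = p $ 3 * w $ 3"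
  shows "minkowski_form w \<ge> 0"
proof -
  let ?n = "(p $ 1)\<^sup>2 + (p $ 2)\<^sup>2" and ?m = "(w $ 1)\<^sup>2 + (w $ 2)\<^sup>2"
  have p3: "(p $ 3)\<^sup>2 = 1 + ?n" using p by (simp add: hyperboloid_def)
  have "(p $ 1 * w $ 1 + p $ 2 * w $ 2)\<^sup>2 + (p $ 1 * w $ 2 - p $ 2 * w $ 1)\<^sup>2 = ?n * ?m"
    by (simp add: power2_eq_square algebra_simps)
  then have "(p $ 3)\<^sup>2 * (w $ 3)\<^sup>2 \<le> ?n * ?m"
    using t by (smt (verit) power_mult_distrib zero_le_power2)
  also have "\<dots> \<le> (p $ 3)\<^sup>2 * ?m" by (simp add: p3 mult_right_mono)
  finally have "(p $ 3)\<^sup>2 * (w $ 3)\<^sup>2 \<le> (p $ 3)\<^sup>2 * ?m" .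
  moreover have "(p $ 3)\<^sup>2 > 0" by (simp add: p3 add_pos_nonneg)
  ultimately show ?thesis by (simp add: minkowski_form_def)
qed

lemma minkowski_form_pushforward_nonneg:
  assumes x: "x \<in> unit_disc"
  shows "minkowski_form (frechet_derivative eta (at x) v) \<ge> 0"
proof (rule minkowski_form_tangent_nonneg[OF eta_in_hyperboloid[OF x]])
  let ?D = "frechet_derivative eta (at x)"
  let ?q = "\<lambda>y. eta y $ 1 * eta y $ 1 + eta y $ 2 * eta y $ 2 - eta y $ 3 * eta y $ 3"
  have D: "(eta has_derivative ?D) (at x)"
    using eta_differentiable[OF x] by (simp add: frechet_derivative_works)
  have c: "((\<lambda>y. eta y $ i) has_derivative (\<lambda>h. ?D h $ i)) (at x)" for i
    by (rule bounded_linear.has_derivative[OF bounded_linear_vec_nth D])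
  have d: "(?q has_derivative (\<lambda>h. (eta x $ 1 * ?D h $ 1 + ?D h $ 1 * eta x $ 1)
      + (eta x $ 2 * ?D h $ 2 + ?D h $ 2 * eta x $ 2)
      - (eta x $ 3 * ?D h $ 3 + ?D h $ 3 * eta x $ 3))) (at x)"
    by (intro has_derivative_add has_derivative_diff has_derivative_mult c)
  have q: "?q y = -1" if "y \<in> unit_disc" for y
    using eta_in_hyperboloid[OF that] by (simp add: hyperboloid_def flip: power2_eq_square)
  have "open unit_disc" unfolding unit_disc_def by (intro open_Collect_less continuous_intros)
  then have "((\<lambda>y. -1) has_derivative (\<lambda>h. (eta x $ 1 * ?D h $ 1 + ?D h $ 1 * eta x $ 1)
      + (eta x $ 2 * ?D h $ 2 + ?D h $ 2 * eta x $ 2)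
      - (eta x $ 3 * ?D h $ 3 + ?D h $ 3 * eta x $ 3))) (at x)"
    by (rule has_derivative_transform_within_open[OF d _ x]) (rule q)
  from fun_cong[OF has_derivative_unique[OF this has_derivative_const], of v]
  show "eta x $ 1 * ?D v $ 1 + eta x $ 2 * ?D v $ 2 = eta x $ 3 * ?D v $ 3"
    by simp
qed

end

theory Submission
  imports Defs
begin

text \<open>Put s = sqrt (1 - |x|^2) and b = <x,v>. Since \<open>eta\<close> x is (x, 1) scaled by
  1/s, and 1/s has derivative b/s^3 in direction v, the product rule gives the pushforward (v/s + x
  b/s^3, b/s^3) (\<open>frechet_derivative_eta\<close>). Its Minkowski form simplifies to (s^2 |v|^2
  + b^2)/s^4, whose root is the first summand of the Funk metric; dividing its third component by
  that of \<open>eta\<close> x, which is 1/s, gives b/s^2, the second summand.\<close>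

lemma has_derivative_inverse_sqrt_one_minus_norm_sq:
  fixes x :: "'a::real_inner"
  assumes "(norm x)\<^sup>2 < 1"
  shows "((\<lambda>y. 1 / sqrt (1 - (norm y)\<^sup>2)) has_derivative
    (\<lambda>h. (x \<bullet> h) / sqrt (1 - (norm x)\<^sup>2) ^ 3)) (at x)"
proof -
  \<comment> \<open>The norm is not differentiable at the centre of the disc; as an inner product,
    its square is differentiable everywhere.\<close>
  have pos: "1 - x \<bullet> x > 0"
    using assms by (simp add: power2_norm_eq_inner)
  then have "((\<lambda>y. inverse (sqrt (1 - y \<bullet> y))) has_derivative
      (\<lambda>h. (x \<bullet> h) / sqrt (1 - x \<bullet> x) ^ 3)) (at x)"
    by (auto intro!: derivative_eq_intros
        simp: fun_eq_iff inner_commute field_simps power3_eq_cube power2_eq_square)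
  then show ?thesis
    by (simp add: power2_norm_eq_inner inverse_eq_divide)
qed

lemma frechet_derivative_eta:
  assumes "x \<in> unit_disc"
  defines "s \<equiv> sqrt (1 - (norm x)\<^sup>2)"
  shows "frechet_derivative eta (at x) v =
    vector [v $ 1 / s + x $ 1 * (x \<bullet> v) / s ^ 3, v $ 2 / s + x $ 2 * (x \<bullet> v) / s ^ 3,
            (x \<bullet> v) / s ^ 3]"
proof -
  define r where "r = (\<lambda>y::real^2. 1 / sqrt (1 - (norm y)\<^sup>2))"
  have r: "(r has_derivative (\<lambda>h. (x \<bullet> h) / s ^ 3)) (at x)"
    unfolding r_def s_def
    using unit_disc_pos[OF assms(1)]
    by (intro has_derivative_inverse_sqrt_one_minus_norm_sq) simp
  have c: "((\<lambda>y::real^2. y $ i) has_derivative (\<lambda>h. h $ i)) (at x)" for i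
    by (rule bounded_linear_imp_has_derivative[OF bounded_linear_vec_nth])
  \<comment> \<open>Splitting along the coordinate axes reduces the vector-valued map to real
    products, to which the product rule applies.\<close>
  have eq: "eta = (\<lambda>y. (y $ 1 * r y) *\<^sub>R axis 1 1 + (y $ 2 * r y) *\<^sub>R axis 2 1
      + r y *\<^sub>R axis 3 1)"
    by (auto simp: fun_eq_iff eta_def vec_eq_iff forall_3 axis_def r_def)
  have "(eta has_derivative (\<lambda>h. (x $ 1 * ((x \<bullet> h) / s ^ 3) + h $ 1 * r x) *\<^sub>R axis 1 1
      + (x $ 2 * ((x \<bullet> h) / s ^ 3) + h $ 2 * r x) *\<^sub>R axis 2 1
      + ((x \<bullet> h) / s ^ 3) *\<^sub>R axis 3 1)) (at x)"
    unfolding eq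
    by (intro has_derivative_add has_derivative_mult c r
        bounded_linear.has_derivative[OF bounded_linear_scaleR_left])
  from frechet_derivative_at[OF this, symmetric] show ?thesis
    by (simp add: vec_eq_iff forall_3 axis_def r_def s_def add.commute)
qed

theorem proposition3p2:
  fixes x v :: "real^2"
  assumes "x \<in> unit_disc"
  shows "pullback eta lorentz_metric x v = funk_metric x v"
proof -
  define s where "s = sqrt (1 - (norm x)\<^sup>2)"
  define b where "b = x \<bullet> v"
  have s: "s > 0" and s2: "s\<^sup>2 = 1 - (norm x)\<^sup>2"
    using unit_disc_pos[OF assms] by (auto simp: s_def)
  have b: "b = x $ 1 * v $ 1 + x $ 2 * v $ 2"
    by (simp add: b_def inner_vec_def sum_2)
  let ?w = "frechet_derivative eta (at x) v"
  have w: "?w $ 1 = v $ 1 / s + x $ 1 * b / s ^ 3" "?w $ 2 = v $ 2 / s + x $ 2 * b / s ^ 3"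
      "?w $ 3 = b / s ^ 3"
    by (simp_all add: frechet_derivative_eta[OF assms] flip: s_def b_def)
  \<comment> \<open>The cross terms of the first two squares give 2 b^2/s^4. Their pure b^2 terms,
    |x|^2 b^2/s^6, combine with -b^2/s^6 from the third component.\<close>
  have "minkowski_form ?w = (norm v)\<^sup>2 / s\<^sup>2 + 2 * b\<^sup>2 / s ^ 4 - (1 - (norm x)\<^sup>2) * b\<^sup>2 / s ^ 6"
  proof -
    have "minkowski_form ?w = ((v $ 1)\<^sup>2 + (v $ 2)\<^sup>2) / s\<^sup>2
        + 2 * (x $ 1 * v $ 1 + x $ 2 * v $ 2) * b / s ^ 4
        - (1 - ((x $ 1)\<^sup>2 + (x $ 2)\<^sup>2)) * b\<^sup>2 / s ^ 6"
      using s unfolding minkowski_form_def w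
      by (simp add: field_simps eval_nat_numeral)
    then show ?thesis
      by (simp add: norm2_sq power2_eq_square[of b] mult.assoc flip: b)
  qed
  \<comment> \<open>As 1 - |x|^2 = s^2, the last term is -b^2/s^4 and cancels half of the middle
    one. Writing the denominator as a square lets the root be taken exactly.\<close>
  also have "\<dots> = (s\<^sup>2 * (norm v)\<^sup>2 + b\<^sup>2) / (s\<^sup>2)\<^sup>2"
    using s unfolding s2[symmetric] by (simp add: field_simps eval_nat_numeral)
  finally have "sqrt (minkowski_form ?w) = sqrt (s\<^sup>2 * (norm v)\<^sup>2 + b\<^sup>2) / s\<^sup>2"
    by (simp only: real_sqrt_divide real_sqrt_abs abs_power2)
  moreover have "?w $ 3 / eta x $ 3 = b / s\<^sup>2"
    using s by (simp add: w eta_def power3_eq_cube power2_eq_square[of s] flip: s_def)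
  ultimately show ?thesis
    by (simp add: pullback_def lorentz_metric_def funk_metric_def s2 b_def)
qed

end
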